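(* For all integers $n \ge 1$: (1) the number of D-permutations on $[2n]$ that consist of a single cycle of length $2n$ is equal to the Genocchi number $g_n$; (2) the number of D-permutations on $[2n]$ is equal to the median Genocchi number $h_n$.
   Context: $[m]=\{1,\dots,m\}$. A permutation $\sigma$ of $[2n]$ is a D-permutation if $i\le\sigma(i)$ whenever $i$ is odd and $i\ge\sigma(i)$ whenever $i$ is even. A Dumont permutation on $[2n]$ is a permutation $\sigma$ of $[2n]$ with $2i>\sigma(2i)$ and $2i-1\le\sigma(2i-1)$ for all $i=1,\dots,n$. A Dumont derangement is a Dumont permutation without fixed points, i.e. $2i>\sigma(2i)$ and $2i-1<\sigma(2i-1)$ for all $i=1,\dots,n$. For $n\ge1$ the Genocchi number $g_n$ is defined as the number of Dumont permutations on $[2n-2]$ (so $g_1=1$), and for $n\ge 0$ the median Genocchi number $h_n$ is defined as the number of Dumont derangements on $[2n+2]$. Thus $(g_n)_{n\ge1}=1,1,3,17,155,\dots$ and $(h_n)_{n\ge0}=1,2,8,56,608,\dots$. *)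

theory Defs
  imports "HOL-Combinatorics.Orbits"
begin

text \<open>
  Permutations of \<open>[2n]\<close> are functions on \<^typ>\<open>nat\<close> that permute \<open>{1..2 * n}\<close> in the library
  sense, i.e. they are the identity outside of \<open>{1..2 * n}\<close>; so counting these functions
  counts the permutations of \<open>[2n]\<close>.  In all predicates below the argument \<open>n\<close> is half the size
  of the ground set.
\<close>

definition D_permutation :: "nat \<Rightarrow> (nat \<Rightarrow> nat) \<Rightarrow> bool" where
  "D_permutation n \<sigma> \<longleftrightarrow> \<sigma> permutes {1..2 * n} \<and>
     (\<forall>i\<in>{1..2 * n}. (odd i \<longrightarrow> i \<le> \<sigma> i) \<and> (even i \<longrightarrow> i \<ge> \<sigma> i))"

definition Dumont_permutation :: "nat \<Rightarrow> (nat \<Rightarrow> nat) \<Rightarrow> bool" where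
  "Dumont_permutation n \<sigma> \<longleftrightarrow> \<sigma> permutes {1..2 * n} \<and>
     (\<forall>i\<in>{1..n}. 2 * i > \<sigma> (2 * i) \<and> 2 * i - 1 \<le> \<sigma> (2 * i - 1))"

definition Dumont_derangement :: "nat \<Rightarrow> (nat \<Rightarrow> nat) \<Rightarrow> bool" where
  "Dumont_derangement n \<sigma> \<longleftrightarrow> Dumont_permutation n \<sigma> \<and> (\<forall>i\<in>{1..2 * n}. \<sigma> i \<noteq> i)"

text \<open>
  The Genocchi number \<open>g\<^sub>n\<close> counts Dumont permutations of \<open>[2n - 2]\<close>.  It is meant for
  \<open>n \<ge> 1\<close> only; the value at \<open>0\<close> is an artefact of truncated subtraction.
\<close>
definition genocchi :: "nat \<Rightarrow> nat" where
  "genocchi n = card {\<sigma>. Dumont_permutation (n - 1) \<sigma>}"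

definition median_genocchi :: "nat \<Rightarrow> nat" where
  "median_genocchi n = card {\<sigma>. Dumont_derangement (n + 1) \<sigma>}"

end

theory Submission
  imports Defs
begin

text \<open>
  Part (2) is a relabelling: if \<open>\<tau>\<close> is a Dumont derangement of \<open>[2n + 2]\<close>, then
  \<open>\<tau> 2 = 1\<close> and \<open>\<tau> (2n + 1) = 2n + 2\<close> are forced; deleting these two entries, lowering every
  value by \<open>1\<close> and every even position by \<open>2\<close> leaves exactly a D-permutation of \<open>[2n]\<close>.

  For part (1), \<open>g\<^sub>n\<close> counts the permutations of \<open>[2n - 1]\<close> that go strictly down at even and
  weakly up at odd positions, because these fix \<open>2n - 1\<close>.  More generally, for any set \<open>S\<close> and any
  \<open>m\<close> above \<open>S\<close>, the permutations of \<open>S\<close> and the cyclic permutations of \<open>S \<union> {m}\<close> with prescribed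
  descents and weak ascents in \<open>S\<close> are equinumerous.  Both counts satisfy the same recursion
  upon deleting the smallest element \<open>a\<close> of \<open>S\<close>: putting \<open>a\<close> behind \<open>p\<close> in the cycle notation
  makes \<open>p\<close> a descent, \<open>a\<close> an ascent and changes nothing else.  The case of a
  fixed point \<open>a\<close> corresponds to the case where \<open>a\<close> is put behind \<open>m\<close>.
\<close>

section \<open>Inserting an element into a permutation\<close>

lemma comp_transpose_permutes_insert:
  assumes "\<sigma> permutes U" "p \<in> insert a U"
  shows "\<sigma> \<circ> transpose a p permutes insert a U"
  using assms
  by (intro permutes_compose permutes_swap_id) (auto intro: permutes_subset)

text \<open>Since \<open>\<sigma>\<close> fixes \<open>a\<close>, the composite sends
  \<open>p\<close> to \<open>a\<close> and \<open>a\<close> to \<open>\<sigma> p\<close>: the new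
  element is spliced into the cycle notation right behind \<open>p\<close>, and \<open>p = a\<close>
  makes it a fixed point. Conversely \<open>p\<close> is the preimage of \<open>a\<close>, and
  composing with the same transposition again gives back \<open>\<sigma>\<close>.\<close>

lemma bij_betw_comp_transpose:
  assumes "a \<notin> U"
  shows "bij_betw (\<lambda>(p, \<sigma>). \<sigma> \<circ> transpose a p) (insert a U \<times> {\<sigma>. \<sigma> permutes U})
           {\<sigma>. \<sigma> permutes insert a U}"
  unfolding bij_betw_def
proof
  have at_p: "(\<sigma> \<circ> transpose a p) p = a" if "\<sigma> permutes U" for p \<sigma>
    using that assms by (simp add: permutes_not_in)
  show "inj_on (\<lambda>(p, \<sigma>). \<sigma> \<circ> transpose a p) (insert a U \<times> {\<sigma>. \<sigma> permutes U})"
  proof (rule inj_onI, clarify)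
    fix p \<sigma> q \<tau>
    assume \<sigma>: "\<sigma> permutes U" and \<tau>: "\<tau> permutes U" and p: "p \<in> insert a U"
      and eq: "\<sigma> \<circ> transpose a p = \<tau> \<circ> transpose a q"
    have "inj (\<sigma> \<circ> transpose a p)"
      using comp_transpose_permutes_insert[OF \<sigma> p] by (rule permutes_inj)
    then have "p = q"
      using at_p[OF \<sigma>, of p] at_p[OF \<tau>, of q] eq by (metis injD)
    moreover have "\<sigma> = \<tau>"
      using eq unfolding \<open>p = q\<close> by (metis comp_assoc comp_id transpose_comp_involutory)
    ultimately show "p = q \<and> \<sigma> = \<tau>" ..
  qed
  show "(\<lambda>(p, \<sigma>). \<sigma> \<circ> transpose a p) ` (insert a U \<times> {\<sigma>. \<sigma> permutes U})
          = {\<sigma>. \<sigma> permutes insert a U}"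
  proof (intro equalityI subsetI)
    fix \<tau> assume "\<tau> \<in> {\<sigma>. \<sigma> permutes insert a U}"
    then have \<tau>: "\<tau> permutes insert a U" by simp
    define p where "p = inv \<tau> a"
    have p: "p \<in> insert a U" "\<tau> p = a"
      using permutes_in_image[OF permutes_inv[OF \<tau>], of a] permutes_inverses(1)[OF \<tau>]
      unfolding p_def by auto
    have "\<tau> \<circ> transpose a p permutes insert a U"
      using \<tau> p by (intro permutes_compose permutes_swap_id) auto
    then have "\<tau> \<circ> transpose a p permutes U"
      by (rule permutes_superset) (use p in auto)
    moreover have "\<tau> = (\<tau> \<circ> transpose a p) \<circ> transpose a p"
      by (simp add: comp_assoc)
    ultimately show "\<tau> \<in> (\<lambda>(p, \<sigma>). \<sigma> \<circ> transpose a p) ` (insert a U \<times> {\<sigma>. \<sigma> permutes U})"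
      using p(1) by (intro image_eqI[where x = "(p, \<tau> \<circ> transpose a p)"]) auto
  qed (auto intro!: comp_transpose_permutes_insert[unfolded comp_def] simp: comp_def)
qed

text \<open>Sorting the permutations by the preimage \<open>p\<close> of \<open>a\<close> turns the
  bijection into a recursion. An arbitrary \<open>P\<close> lets it serve both with and without the
  demand of cyclicity.\<close>

lemma card_permutes_insert:
  assumes "finite U" "a \<notin> U"
  shows "card {\<tau>. \<tau> permutes insert a U \<and> P \<tau>} =
         (\<Sum>p\<in>insert a U. card {\<sigma>. \<sigma> permutes U \<and> P (\<sigma> \<circ> transpose a p)})"
proof -
  define f where "f = (\<lambda>(p, \<sigma>). \<sigma> \<circ> transpose a p :: 'a \<Rightarrow> 'a)"
  let ?Y = "\<lambda>p. {\<sigma>. \<sigma> permutes U \<and> P (\<sigma> \<circ> transpose a p)}"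
  have f: "f (p, \<sigma>) = \<sigma> \<circ> transpose a p" for p \<sigma>
    by (simp add: f_def)
  have bij: "bij_betw f (insert a U \<times> {\<sigma>. \<sigma> permutes U}) {\<sigma>. \<sigma> permutes insert a U}"
    unfolding f_def by (rule bij_betw_comp_transpose[OF assms(2)])
  have "f ` Sigma (insert a U) ?Y = {\<tau>. \<tau> permutes insert a U \<and> P \<tau>}"
  proof (intro equalityI subsetI)
    fix \<tau> assume \<tau>: "\<tau> \<in> {\<tau>. \<tau> permutes insert a U \<and> P \<tau>}"
    then have "\<tau> \<in> f ` (insert a U \<times> {\<sigma>. \<sigma> permutes U})"
      unfolding bij_betw_imp_surj_on[OF bij] by simp
    then obtain p \<sigma> where p: "p \<in> insert a U" and \<sigma>: "\<sigma> permutes U" and eq: "\<tau> = f (p, \<sigma>)"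
      by blast
    have "\<sigma> \<in> ?Y p" using \<tau> \<sigma> unfolding eq f by simp
    then show "\<tau> \<in> f ` Sigma (insert a U) ?Y"
      unfolding eq by (intro imageI SigmaI p)
  next
    fix \<tau> assume "\<tau> \<in> f ` Sigma (insert a U) ?Y"
    then obtain p \<sigma> where p: "p \<in> insert a U" and \<sigma>: "\<sigma> \<in> ?Y p" and eq: "\<tau> = f (p, \<sigma>)"
      by blast
    show "\<tau> \<in> {\<tau>. \<tau> permutes insert a U \<and> P \<tau>}"
      using comp_transpose_permutes_insert[OF _ p] \<sigma> unfolding eq f by simp
  qed
  moreover have "inj_on f (Sigma (insert a U) ?Y)"
    by (rule inj_on_subset[OF bij_betw_imp_inj_on[OF bij]]) blast
  ultimately have "card {\<tau>. \<tau> permutes insert a U \<and> P \<tau>} = card (Sigma (insert a U) ?Y)"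
    using card_image[of f "Sigma (insert a U) ?Y"] by simp
  moreover have "finite (?Y p)" for p
    by (rule finite_subset[OF _ finite_permutations[OF assms(1)]]) blast
  ultimately show ?thesis
    using card_SigmaI[of "insert a U" ?Y] assms(1) by simp
qed

section \<open>Cyclic permutations\<close>

text \<open>An orbit is the least closed set generated by its starting point, so forming a single
  orbit means having no proper nonempty invariant subset. Invariant sets are easier to follow
  through an insertion than orbits are.\<close>

lemma cyclic_on_iff_minimal_closed:
  assumes "f ` S \<subseteq> S"
  shows "cyclic_on f S \<longleftrightarrow> S \<noteq> {} \<and> (\<forall>T\<subseteq>S. T \<noteq> {} \<longrightarrow> f ` T \<subseteq> T \<longrightarrow> T = S)"
proof (intro iffI conjI allI impI)
  assume cyc: "cyclic_on f S"
  then show "S \<noteq> {}" by (auto simp: cyclic_on_def)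
  fix T assume T: "T \<subseteq> S" "T \<noteq> {}" "f ` T \<subseteq> T"
  then obtain s where s: "s \<in> T" by auto
  have "x \<in> T" if "x \<in> orbit f s" for x
    using that by induction (use s T(3) in auto)
  moreover have "orbit f s = S"
    using cyc s T(1) by (auto simp: cyclic_on_alldef)
  ultimately show "T = S" using T(1) by auto
next
  assume min: "S \<noteq> {} \<and> (\<forall>T\<subseteq>S. T \<noteq> {} \<longrightarrow> f ` T \<subseteq> T \<longrightarrow> T = S)"
  then obtain s where s: "s \<in> S" by auto
  have "x \<in> S" if "x \<in> orbit f s" for x
    using that by induction (use s assms in auto)
  \<comment> \<open>The orbit contains \<open>f s\<close> and is closed under \<open>f\<close>, so
    minimality forces it to be all of \<open>S\<close>.\<close>
  then have "orbit f s = S"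
    using min orbit.base[of f s] orbit.step[of _ f s] by (metis empty_iff image_subset_iff subsetI)
  then show "cyclic_on f S"
    using s by (auto simp: cyclic_on_def)
qed

text \<open>Splicing \<open>a\<close> behind some \<open>p\<close> in \<open>U\<close> lengthens one
  cycle and leaves the number of cycles unchanged. The proof translates invariant sets in both
  directions.\<close>

lemma cyclic_on_comp_transpose_iff:
  assumes \<sigma>: "\<sigma> permutes U" and a: "a \<notin> U" and p: "p \<in> U"
  shows "cyclic_on (\<sigma> \<circ> transpose a p) (insert a U) \<longleftrightarrow> cyclic_on \<sigma> U"
proof -
  define \<tau> where "\<tau> = \<sigma> \<circ> transpose a p"
  have \<tau>: "\<tau> permutes insert a U"
    using comp_transpose_permutes_insert[OF \<sigma>, of p a] p unfolding \<tau>_def by simp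
  have \<tau>_p: "\<tau> p = a" and \<tau>_a: "\<tau> a = \<sigma> p" and \<tau>_x: "\<And>x. x \<noteq> p \<Longrightarrow> x \<noteq> a \<Longrightarrow> \<tau> x = \<sigma> x"
    using \<sigma> a by (auto simp: \<tau>_def permutes_not_in)
  have \<sigma>_in: "\<sigma> x \<in> U" if "x \<in> U" for x
    using that \<sigma> by (simp add: permutes_in_image)
  have iff\<tau>: "cyclic_on \<tau> (insert a U) \<longleftrightarrow>
      (\<forall>T\<subseteq>insert a U. T \<noteq> {} \<longrightarrow> \<tau> ` T \<subseteq> T \<longrightarrow> T = insert a U)"
    using cyclic_on_iff_minimal_closed[of \<tau> "insert a U"] permutes_image[OF \<tau>] by blast
  have iff\<sigma>: "cyclic_on \<sigma> U \<longleftrightarrow> (\<forall>T\<subseteq>U. T \<noteq> {} \<longrightarrow> \<sigma> ` T \<subseteq> T \<longrightarrow> T = U)"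
    using cyclic_on_iff_minimal_closed[of \<sigma> U] permutes_image[OF \<sigma>] p by blast
  show ?thesis
    unfolding \<tau>_def[symmetric] iff\<tau> iff\<sigma>
  proof (intro iffI allI impI)
    fix T
    assume min: "\<forall>T\<subseteq>insert a U. T \<noteq> {} \<longrightarrow> \<tau> ` T \<subseteq> T \<longrightarrow> T = insert a U"
      and T: "T \<subseteq> U" "T \<noteq> {}" "\<sigma> ` T \<subseteq> T"
    \<comment> \<open>Only \<open>p\<close> is sent to \<open>a\<close>, so \<open>a\<close> has to
      join exactly when \<open>p\<close> is present; its own image \<open>\<sigma> p\<close> then
      lies in \<open>T\<close> already.\<close>
    define T' where "T' = (if p \<in> T then insert a T else T)"
    have "\<tau> x \<in> T'" if "x \<in> T'" for x
      using that T a \<tau>_p \<tau>_a \<tau>_x[of x]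
      by (cases "x = p"; cases "x = a") (auto simp: T'_def split: if_splits)
    moreover have "T' \<subseteq> insert a U" "T' \<noteq> {}"
      using T by (auto simp: T'_def)
    ultimately have "T' = insert a U" using min by blast
    then show "T = U"
      using T(1) a by (auto simp: T'_def split: if_splits)
  next
    fix T
    assume min: "\<forall>T\<subseteq>U. T \<noteq> {} \<longrightarrow> \<sigma> ` T \<subseteq> T \<longrightarrow> T = U"
      and T: "T \<subseteq> insert a U" "T \<noteq> {}" "\<tau> ` T \<subseteq> T"
    have closed: "\<tau> x \<in> T" if "x \<in> T" for x
      using that T(3) by blast
    \<comment> \<open>Where \<open>\<tau>\<close> goes from \<open>p\<close> through
      \<open>a\<close> to \<open>\<sigma> p\<close>, the map \<open>\<sigma>\<close> takes the
      shortcut, so removing \<open>a\<close> keeps the set closed.\<close>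
    have "\<sigma> x \<in> T - {a}" if "x \<in> T - {a}" for x
    proof -
      have "\<sigma> x \<noteq> a" using that T(1) \<sigma>_in[of x] a by auto
      moreover have "\<sigma> x \<in> T"
        using that closed[of x] closed[of a] \<tau>_p \<tau>_a \<tau>_x[of x] by (cases "x = p") auto
      ultimately show ?thesis by simp
    qed
    moreover have "T - {a} \<noteq> {}"
    proof
      assume "T - {a} = {}"
      then have "T = {a}" using T(2) by auto
      then have "\<sigma> p = a" using closed[of a] \<tau>_a by auto
      then show False using \<sigma>_in[OF p] a by auto
    qed
    moreover have "T - {a} \<subseteq> U" using T(1) by auto
    ultimately have "T - {a} = U" using min by blast
    moreover from this have "a \<in> T" using closed[of p] p \<tau>_p by auto
    ultimately show "T = insert a U" by auto
  qed
qed

text \<open>A fixed point is an orbit by itself. This excludes the insertion with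
  \<open>p = a\<close> on the cyclic side, and later all fixed points of D-cycles.\<close>

lemma not_cyclic_on_insert_fixed:
  assumes "f a = a" "a \<notin> U" "U \<noteq> {}"
  shows "\<not> cyclic_on f (insert a U)"
proof
  assume "cyclic_on f (insert a U)"
  then have "orbit f a = insert a U" by (simp add: cyclic_on_alldef)
  moreover have "x = a" if "x \<in> orbit f a" for x
    using that by induction (use assms(1) in auto)
  ultimately show False using assms(2,3) by auto
qed

section \<open>Permutations with prescribed descents and weak ascents\<close>

text \<open>\<open>D\<close> and \<open>A\<close> are arbitrary rather than the even and odd
  elements, because the recursion removes elements from both.\<close>

definition descends_ascends :: "'a::linorder set \<Rightarrow> 'a set \<Rightarrow> ('a \<Rightarrow> 'a) \<Rightarrow> bool" where
  "descends_ascends D A \<sigma> \<longleftrightarrow> (\<forall>x\<in>D. \<sigma> x < x) \<and> (\<forall>x\<in>A. x \<le> \<sigma> x)"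

text \<open>As \<open>a\<close> is the minimum, it ascends weakly whatever its image. The point
  \<open>p\<close>, now sent to \<open>a\<close>, descends if \<open>p\<close> differs from
  \<open>a\<close>: its demand in \<open>D\<close> is met for free and a demand in \<open>A\<close>
  is violated. All other points keep their images.\<close>

lemma descends_ascends_comp_transpose_iff:
  assumes \<sigma>: "\<sigma> permutes U" and p: "p \<in> insert a U" and a: "\<forall>x\<in>U. a < x"
    and D: "D \<subseteq> U" and A: "A \<subseteq> insert a U"
  shows "descends_ascends D A (\<sigma> \<circ> transpose a p) \<longleftrightarrow>
         p \<notin> A - {a} \<and> descends_ascends (D - {p}) (A - {a}) \<sigma>"
proof -
  define \<tau> where "\<tau> = \<sigma> \<circ> transpose a p"
  have a_U: "a \<notin> U" using a by auto
  have \<tau>_p: "\<tau> p = a" and \<tau>_x: "\<And>x. x \<noteq> p \<Longrightarrow> x \<noteq> a \<Longrightarrow> \<tau> x = \<sigma> x"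
    using \<sigma> a_U by (auto simp: \<tau>_def permutes_not_in)
  have "\<tau> permutes insert a U"
    unfolding \<tau>_def by (rule comp_transpose_permutes_insert[OF \<sigma> p])
  then have "\<tau> a \<in> insert a U"
    using permutes_in_image by (metis insertI1)
  then have \<tau>_a: "a \<le> \<tau> a" using a by auto
  have "(\<forall>x\<in>D. \<tau> x < x) \<longleftrightarrow> (\<forall>x\<in>D - {p}. \<sigma> x < x)"
  proof -
    have "\<tau> x < x \<longleftrightarrow> x = p \<or> \<sigma> x < x" if "x \<in> D" for x
    proof (cases "x = p")
      case True
      then show ?thesis using that D a \<tau>_p by auto
    next
      case False
      moreover have "x \<noteq> a" using that D a_U by auto
      ultimately show ?thesis using \<tau>_x[of x] using False by auto
    qed
    then show ?thesis by blast
  qed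
  moreover have "(\<forall>x\<in>A. x \<le> \<tau> x) \<longleftrightarrow> p \<notin> A - {a} \<and> (\<forall>x\<in>A - {a}. x \<le> \<sigma> x)"
  proof -
    have "x \<le> \<tau> x \<longleftrightarrow> x \<noteq> p \<and> x \<le> \<sigma> x" if "x \<in> A - {a}" for x
    proof (cases "x = p")
      case True
      have "a < x" using that A a by auto
      then show ?thesis using True \<tau>_p by auto
    next
      case False
      then show ?thesis using that \<tau>_x[of x] by auto
    qed
    then show ?thesis using \<tau>_a by blast
  qed
  ultimately show ?thesis
    unfolding descends_ascends_def \<tau>_def[symmetric] by blast
qed

lemma not_descends_at_least:
  assumes "\<sigma> permutes U" "a \<in> U" "\<forall>x\<in>U. a \<le> x" "a \<in> D"
  shows "\<not> descends_ascends D A \<sigma>"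
  using assms permutes_in_image[of \<sigma> U a] by (fastforce simp: descends_ascends_def)

text \<open>The induction adds elements from the top down, so the new element is always the minimum;
  \<open>D\<close> and \<open>A\<close> must vary since every insertion drops demands.\<close>

lemma card_descends_ascends_eq_card_cyclic:
  fixes S :: "'a::linorder set"
  assumes "finite S" "\<forall>x\<in>S. x < m" "D \<subseteq> S" "A \<subseteq> S"
  shows "card {\<sigma>. \<sigma> permutes S \<and> descends_ascends D A \<sigma>} =
         card {\<sigma>. \<sigma> permutes insert m S \<and> cyclic_on \<sigma> (insert m S) \<and> descends_ascends D A \<sigma>}"
  using assms
proof (induction S arbitrary: D A rule: finite_linorder_min_induct)
  case empty
  have "cyclic_on id {m}"
    by (subst cyclic_on_iff_minimal_closed) auto
  then have "{\<sigma>. \<sigma> permutes {m} \<and> cyclic_on \<sigma> {m} \<and> descends_ascends {} {} \<sigma>} = {id}"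
    by (auto simp: descends_ascends_def permutes_sing)
  moreover have "{\<sigma> :: 'a \<Rightarrow> 'a. \<sigma> permutes {} \<and> descends_ascends {} {} \<sigma>} = {id}"
    by (auto simp: descends_ascends_def)
  ultimately show ?case using empty by simp
next
  case (insert a S)
  have a_S: "a \<notin> S" "a \<noteq> m" "m \<notin> S"
    using insert.hyps insert.prems by auto
  show ?case
  proof (cases "a \<in> D")
    case True
    \<comment> \<open>The least element cannot go down, so both counts are zero.\<close>
    then have "\<not> descends_ascends D A \<sigma>" if "\<sigma> permutes insert a S" for \<sigma>
      using that insert.hyps by (intro not_descends_at_least[of _ "insert a S" a]) auto
    moreover have "\<not> descends_ascends D A \<sigma>" if "\<sigma> permutes insert m (insert a S)" for \<sigma>
      using that insert.hyps insert.prems True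
      by (intro not_descends_at_least[of _ "insert m (insert a S)" a]) auto
    ultimately show ?thesis
      by (metis (mono_tags, lifting) empty_Collect_eq)
  next
    case False
    then have D: "D \<subseteq> S" using insert.prems by auto
    \<comment> \<open>\<open>F p\<close> and \<open>C p\<close> are the two counts that remain once
      \<open>a\<close> stands behind \<open>p\<close>; the induction hypothesis identifies
      them.\<close>
    define F where "F p = card {\<sigma>. \<sigma> permutes S \<and> descends_ascends (D - {p}) (A - {a}) \<sigma>}" for p
    define C where "C p = card {\<sigma>. \<sigma> permutes insert m S \<and> cyclic_on \<sigma> (insert m S) \<and>
      descends_ascends (D - {p}) (A - {a}) \<sigma>}" for p
    have F_eq_C: "F p = C p" for p
      unfolding F_def C_def using insert.prems D by (intro insert.IH) auto
    \<comment> \<open>Neither \<open>a\<close> nor \<open>m\<close> lies in \<open>D\<close>. This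
      equality matches the fixed point \<open>a\<close> on one side with \<open>a\<close> behind
      \<open>m\<close> on the other.\<close>
    have F_same: "F a = F m"
    proof -
      have "D - {a} = D" "D - {m} = D" using D a_S by auto
      then show ?thesis unfolding F_def by simp
    qed
    have "card {\<sigma>. \<sigma> permutes insert a S \<and> descends_ascends D A \<sigma>} =
        (\<Sum>p\<in>insert a S. card {\<sigma>. \<sigma> permutes S \<and> descends_ascends D A (\<sigma> \<circ> transpose a p)})"
      by (rule card_permutes_insert) (use insert.hyps a_S in auto)
    also have "\<dots> = (\<Sum>p\<in>insert a S. if p \<in> A - {a} then 0 else F p)"
    proof (rule sum.cong[OF refl])
      fix p assume p: "p \<in> insert a S"
      have "{\<sigma>. \<sigma> permutes S \<and> descends_ascends D A (\<sigma> \<circ> transpose a p)} =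
            {\<sigma>. \<sigma> permutes S \<and> p \<notin> A - {a} \<and> descends_ascends (D - {p}) (A - {a}) \<sigma>}"
        using descends_ascends_comp_transpose_iff[OF _ p _ D] insert.hyps insert.prems by blast
      then show "card {\<sigma>. \<sigma> permutes S \<and> descends_ascends D A (\<sigma> \<circ> transpose a p)} =
          (if p \<in> A - {a} then 0 else F p)"
        by (simp add: F_def)
    qed
    also have "\<dots> = F a + (\<Sum>p\<in>S. if p \<in> A - {a} then 0 else F p)"
      using insert.hyps a_S by simp
    finally have perms: "card {\<sigma>. \<sigma> permutes insert a S \<and> descends_ascends D A \<sigma>} =
      F a + (\<Sum>p\<in>S. if p \<in> A - {a} then 0 else F p)" .
    let ?U = "insert m S"
    have U: "\<forall>x\<in>?U. a < x" "a \<notin> ?U" "finite ?U"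
      using insert.hyps insert.prems by auto
    have "card {\<sigma>. \<sigma> permutes insert a ?U \<and> cyclic_on \<sigma> (insert a ?U) \<and> descends_ascends D A \<sigma>} =
        (\<Sum>p\<in>insert a ?U. card {\<sigma>. \<sigma> permutes ?U \<and> cyclic_on (\<sigma> \<circ> transpose a p) (insert a ?U) \<and>
           descends_ascends D A (\<sigma> \<circ> transpose a p)})"
      by (rule card_permutes_insert) (use U in auto)
    also have "\<dots> = (\<Sum>p\<in>insert a ?U. if p = a \<or> p \<in> A - {a} then 0 else C p)"
    proof (rule sum.cong[OF refl])
      fix p assume p: "p \<in> insert a ?U"
      have desc: "descends_ascends D A (\<sigma> \<circ> transpose a p) \<longleftrightarrow>
          p \<notin> A - {a} \<and> descends_ascends (D - {p}) (A - {a}) \<sigma>" if "\<sigma> permutes ?U" for \<sigma>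
        by (rule descends_ascends_comp_transpose_iff[OF that p U(1)])
          (use D insert.prems in auto)
      have cyc: "cyclic_on (\<sigma> \<circ> transpose a p) (insert a ?U) \<longleftrightarrow> p \<noteq> a \<and> cyclic_on \<sigma> ?U"
        if \<sigma>: "\<sigma> permutes ?U" for \<sigma>
      proof (cases "p = a")
        case True
        then show ?thesis
          using not_cyclic_on_insert_fixed[of \<sigma> a ?U] \<sigma> U(2) by (auto simp: permutes_not_in)
      next
        case False
        then show ?thesis
          using cyclic_on_comp_transpose_iff[OF \<sigma> U(2), of p] p by auto
      qed
      have "{\<sigma>. \<sigma> permutes ?U \<and> cyclic_on (\<sigma> \<circ> transpose a p) (insert a ?U) \<and>
             descends_ascends D A (\<sigma> \<circ> transpose a p)} =
            {\<sigma>. \<sigma> permutes ?U \<and> \<not> (p = a \<or> p \<in> A - {a}) \<and> cyclic_on \<sigma> ?U \<and>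
             descends_ascends (D - {p}) (A - {a}) \<sigma>}"
        using desc cyc by blast
      then show "card {\<sigma>. \<sigma> permutes ?U \<and> cyclic_on (\<sigma> \<circ> transpose a p) (insert a ?U) \<and>
             descends_ascends D A (\<sigma> \<circ> transpose a p)} =
          (if p = a \<or> p \<in> A - {a} then 0 else C p)"
        by (simp add: C_def)
    qed
    also have "\<dots> = (\<Sum>p\<in>?U. if p = a \<or> p \<in> A - {a} then 0 else C p)"
      using U by simp
    also have "\<dots> = (\<Sum>p\<in>?U. if p \<in> A - {a} then 0 else C p)"
      by (rule sum.cong) (use U in auto)
    \<comment> \<open>No ascent is demanded at \<open>m\<close>, so the term for \<open>m\<close>
      survives and takes the place of \<open>F a\<close>.\<close>
    also have "\<dots> = C m + (\<Sum>p\<in>S. if p \<in> A - {a} then 0 else C p)"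
      using U a_S insert.prems by auto
    finally show ?thesis
      using perms F_same unfolding ext[of F C, OF F_eq_C] insert_commute[of m a] by simp
  qed
qed

section \<open>D-cycles and Dumont permutations\<close>

lemma Dumont_permutation_iff:
  "Dumont_permutation n \<sigma> \<longleftrightarrow> \<sigma> permutes {1..2 * n} \<and>
     (\<forall>i\<in>{1..2 * n}. (odd i \<longrightarrow> i \<le> \<sigma> i) \<and> (even i \<longrightarrow> \<sigma> i < i))"
proof -
  have "(\<forall>i\<in>{1..n}. 2 * i > \<sigma> (2 * i) \<and> 2 * i - 1 \<le> \<sigma> (2 * i - 1)) \<longleftrightarrow>
        (\<forall>i\<in>{1..2 * n}. (odd i \<longrightarrow> i \<le> \<sigma> i) \<and> (even i \<longrightarrow> \<sigma> i < i))" (is "?L \<longleftrightarrow> ?R")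
  proof
    assume L: ?L
    show ?R
    proof (intro ballI conjI impI)
      fix i assume i: "i \<in> {1..2 * n}" "odd i"
      then obtain k where k: "i = 2 * k + 1" by (elim oddE)
      then have "k + 1 \<in> {1..n}" using i by simp
      then have "2 * (k + 1) - 1 \<le> \<sigma> (2 * (k + 1) - 1)" using L by blast
      then show "i \<le> \<sigma> i" by (simp add: k)
    next
      fix i assume i: "i \<in> {1..2 * n}" "even i"
      then obtain k where k: "i = 2 * k" by (elim evenE)
      then have "k \<in> {1..n}" using i by simp
      then show "\<sigma> i < i" using L unfolding k by blast
    qed
  next
    assume R: ?R
    show ?L
    proof
      fix i assume i: "i \<in> {1..n}"
      then have "2 * i \<in> {1..2 * n}" "2 * i - 1 \<in> {1..2 * n}" by auto
      moreover have "even (2 * i)" "odd (2 * i - 1)" using i by simp_all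
      ultimately show "2 * i > \<sigma> (2 * i) \<and> 2 * i - 1 \<le> \<sigma> (2 * i - 1)"
        using R by blast
    qed
  qed
  then show ?thesis unfolding Dumont_permutation_def by blast
qed

text \<open>The general count is applied to the set of all numbers up to \<open>2 * n - 1\<close>,
  with \<open>m = 2 * n\<close>. It remains to identify its two sides with D-cycles and with Dumont
  permutations.\<close>

lemma card_D_cycles:
  assumes "n \<ge> 1"
  shows "card {\<sigma>. D_permutation n \<sigma> \<and> cyclic_on \<sigma> {1..2 * n}} = genocchi n"
proof -
  let ?S = "{1..2 * n - 1}"
  let ?D = "{x \<in> ?S. even x}" and ?A = "{x \<in> ?S. odd x}"
  have ins: "insert (2 * n) ?S = {1..2 * n}" using assms by auto
  have cycles: "{\<sigma>. D_permutation n \<sigma> \<and> cyclic_on \<sigma> {1..2 * n}} =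
     {\<sigma>. \<sigma> permutes {1..2 * n} \<and> cyclic_on \<sigma> {1..2 * n} \<and> descends_ascends ?D ?A \<sigma>}"
  proof (intro Collect_cong iffI; elim conjE; intro conjI)
    fix \<sigma> assume D: "D_permutation n \<sigma>" and cyc: "cyclic_on \<sigma> {1..2 * n}"
    show "\<sigma> permutes {1..2 * n}" using D by (simp add: D_permutation_def)
    \<comment> \<open>A cycle of length at least two has no fixed point, which makes the weak
      inequality at even positions strict.\<close>
    have "\<sigma> x \<noteq> x" if "x \<in> {1..2 * n}" for x
    proof -
      have "{1..2 * n} - {x} \<noteq> {}"
      proof (cases "x = 1")
        case True
        then have "2 \<in> {1..2 * n} - {x}" using assms by auto
        then show ?thesis by blast
      next
        case False
        then have "1 \<in> {1..2 * n} - {x}" using assms by auto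
        then show ?thesis by blast
      qed
      then show ?thesis
        using not_cyclic_on_insert_fixed[of \<sigma> x "{1..2 * n} - {x}"] cyc that
        by (auto simp: insert_absorb)
    qed
    moreover have "(odd x \<longrightarrow> x \<le> \<sigma> x) \<and> (even x \<longrightarrow> \<sigma> x \<le> x)" if "x \<in> {1..2 * n}" for x
      using D that unfolding D_permutation_def by blast
    moreover have "?S \<subseteq> {1..2 * n}" by auto
    ultimately show "descends_ascends ?D ?A \<sigma>"
      unfolding descends_ascends_def by (blast intro: order.not_eq_order_implies_strict)
  next
    fix \<sigma> assume \<sigma>: "\<sigma> permutes {1..2 * n}" and desc: "descends_ascends ?D ?A \<sigma>"
    have "(odd i \<longrightarrow> i \<le> \<sigma> i) \<and> (even i \<longrightarrow> \<sigma> i \<le> i)" if "i \<in> {1..2 * n}" for i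
    proof (cases "i = 2 * n")
      \<comment> \<open>The top element \<open>2 * n\<close> is even and satisfies its weak
        inequality automatically.\<close>
      case True
      then show ?thesis using permutes_in_image[OF \<sigma>, of i] that by auto
    next
      case False
      then have "i \<in> ?S" using that by auto
      then show ?thesis using desc by (auto simp: descends_ascends_def less_imp_le)
    qed
    then show "D_permutation n \<sigma>" using \<sigma> by (simp add: D_permutation_def)
  qed
  have card_eq: "card {\<sigma>. \<sigma> permutes {1..2 * n} \<and> cyclic_on \<sigma> {1..2 * n} \<and> descends_ascends ?D ?A \<sigma>} =
      card {\<sigma>. \<sigma> permutes ?S \<and> descends_ascends ?D ?A \<sigma>}"
    unfolding ins[symmetric]
    by (rule card_descends_ascends_eq_card_cyclic[symmetric]) auto
  have dumont: "{\<sigma>. \<sigma> permutes ?S \<and> descends_ascends ?D ?A \<sigma>} = {\<sigma>. Dumont_permutation (n - 1) \<sigma>}"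
  proof (rule Collect_cong, rule iffI)
    fix \<sigma> assume "\<sigma> permutes ?S \<and> descends_ascends ?D ?A \<sigma>"
    then have \<sigma>: "\<sigma> permutes ?S" and desc: "descends_ascends ?D ?A \<sigma>"
      by blast+
    have "odd (2 * n - 1)" using assms by simp
    then have top: "2 * n - 1 \<in> ?A" using assms by simp
    then have "\<sigma> (2 * n - 1) = 2 * n - 1"
    proof (intro antisym)
      have "\<sigma> (2 * n - 1) \<in> ?S" using top permutes_in_image[OF \<sigma>] by blast
      then show "\<sigma> (2 * n - 1) \<le> 2 * n - 1" by simp
      show "2 * n - 1 \<le> \<sigma> (2 * n - 1)"
        using desc top unfolding descends_ascends_def by blast
    qed
    moreover have "?S - {1..2 * (n - 1)} \<subseteq> {2 * n - 1}" by auto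
    ultimately have "\<sigma> permutes {1..2 * (n - 1)}"
      by (intro permutes_superset[OF \<sigma>]) blast
    then show "Dumont_permutation (n - 1) \<sigma>"
      using desc by (auto simp: Dumont_permutation_iff descends_ascends_def)
  next
    fix \<sigma> assume dumont: "Dumont_permutation (n - 1) \<sigma>"
    then have \<sigma>: "\<sigma> permutes {1..2 * (n - 1)}" by (simp add: Dumont_permutation_iff)
    have "(odd x \<longrightarrow> x \<le> \<sigma> x) \<and> (even x \<longrightarrow> \<sigma> x < x)" if "x \<in> ?S" for x
    proof (cases "x \<in> {1..2 * (n - 1)}")
      case True
      then show ?thesis using dumont by (auto simp: Dumont_permutation_iff)
    next
      case False
      then have "x = 2 * n - 1" using that by auto
      moreover have "\<sigma> x = x" using permutes_not_in[OF \<sigma> False] .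
      moreover have "odd (2 * n - 1)" using assms by auto
      ultimately show ?thesis by simp
    qed
    moreover have "\<sigma> permutes ?S" by (rule permutes_subset[OF \<sigma>]) auto
    ultimately show "\<sigma> permutes ?S \<and> descends_ascends ?D ?A \<sigma>"
      by (auto simp: descends_ascends_def)
  qed
  show ?thesis unfolding cycles card_eq dumont genocchi_def ..
qed

section \<open>D-permutations and Dumont derangements\<close>

lemma Dumont_derangement_iff:
  "Dumont_derangement n \<sigma> \<longleftrightarrow> \<sigma> permutes {1..2 * n} \<and>
     (\<forall>i\<in>{1..2 * n}. (odd i \<longrightarrow> i < \<sigma> i) \<and> (even i \<longrightarrow> \<sigma> i < i))"
proof -
  have "((odd i \<longrightarrow> i \<le> \<sigma> i) \<and> (even i \<longrightarrow> \<sigma> i < i)) \<and> \<sigma> i \<noteq> i \<longleftrightarrow>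
        (odd i \<longrightarrow> i < \<sigma> i) \<and> (even i \<longrightarrow> \<sigma> i < i)" for i
    by auto
  then show ?thesis
    unfolding Dumont_derangement_def Dumont_permutation_iff by blast
qed

text \<open>The shifts keep the parity of positions and make strict inequalities weak:
  \<open>j < \<tau> j\<close> becomes \<open>j \<le> \<tau> j - 1\<close>, and
  \<open>\<tau> (j + 2) < j + 2\<close> becomes \<open>\<tau> (j + 2) - 1 \<le> j\<close>. Positions
  \<open>2\<close> and \<open>2 * n + 1\<close> are never read.\<close>

definition shrink_derangement :: "nat \<Rightarrow> (nat \<Rightarrow> nat) \<Rightarrow> nat \<Rightarrow> nat" where
  "shrink_derangement n \<tau> j =
     (if j \<in> {1..2 * n} then \<tau> (if even j then j + 2 else j) - 1 else j)"

definition expand_permutation :: "nat \<Rightarrow> (nat \<Rightarrow> nat) \<Rightarrow> nat \<Rightarrow> nat" where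
  "expand_permutation n \<sigma> i =
     (if i \<notin> {1..2 * (n + 1)} then i
      else if i = 2 then 1
      else if i = 2 * n + 1 then 2 * (n + 1)
      else \<sigma> (if even i then i - 2 else i) + 1)"

lemma permutes_if_inj_on:
  assumes "finite S" "inj_on f S" "\<And>x. x \<in> S \<Longrightarrow> f x \<in> S" "\<And>x. x \<notin> S \<Longrightarrow> f x = x"
  shows "f permutes S"
proof (rule bij_imp_permutes)
  have "f ` S = S" using assms by (intro endo_inj_surj) auto
  then show "bij_betw f S S" using assms(2) by (simp add: bij_betw_def)
qed (use assms in auto)

text \<open>Only \<open>1\<close> lies strictly below \<open>2\<close>, and only
  \<open>2 * (n + 1)\<close> lies strictly above \<open>2 * n + 1\<close>.\<close>

lemma Dumont_derangement_forced:
  assumes "Dumont_derangement (n + 1) \<tau>"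
  shows "\<tau> 2 = 1" "\<tau> (2 * n + 1) = 2 * (n + 1)"
proof -
  have \<tau>: "\<tau> permutes {1..2 * (n + 1)}" and
    step: "\<And>i. i \<in> {1..2 * (n + 1)} \<Longrightarrow> (odd i \<longrightarrow> i < \<tau> i) \<and> (even i \<longrightarrow> \<tau> i < i)"
    using assms unfolding Dumont_derangement_iff by blast+
  show "\<tau> 2 = 1"
    using step[of 2] permutes_in_image[OF \<tau>, of 2] by auto
  show "\<tau> (2 * n + 1) = 2 * (n + 1)"
    using step[of "2 * n + 1"] permutes_in_image[OF \<tau>, of "2 * n + 1"] by auto
qed

lemma D_permutation_shrink_derangement:
  assumes "Dumont_derangement (n + 1) \<tau>"
  shows "D_permutation n (shrink_derangement n \<tau>)"
proof -
  define pos where "pos j = (if even j then j + 2 else j)" for j :: nat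
  have \<tau>: "\<tau> permutes {1..2 * (n + 1)}" and
    step: "\<And>i. i \<in> {1..2 * (n + 1)} \<Longrightarrow> (odd i \<longrightarrow> i < \<tau> i) \<and> (even i \<longrightarrow> \<tau> i < i)"
    using assms unfolding Dumont_derangement_iff by blast+
  note forced = Dumont_derangement_forced[OF assms]
  have pos_in: "pos j \<in> {1..2 * (n + 1)}" "pos j \<noteq> 2" "pos j \<noteq> 2 * n + 1"
    if "j \<in> {1..2 * n}" for j
  proof -
    have "\<exists>k. j = 2 * k \<and> pos j = 2 * k + 2 \<or> j = 2 * k + 1 \<and> pos j = 2 * k + 1"
      unfolding pos_def by (cases "even j"; simp; presburger)
    then show "pos j \<in> {1..2 * (n + 1)}" "pos j \<noteq> 2" "pos j \<noteq> 2 * n + 1"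
      using that unfolding atLeastAtMost_iff by presburger+
  qed
  \<comment> \<open>The extreme values are taken at the two forced positions. Hence lowering by one
    stays in range, and the truncated subtraction remains injective.\<close>
  have range: "2 \<le> \<tau> (pos j) \<and> \<tau> (pos j) \<le> 2 * n + 1" if j: "j \<in> {1..2 * n}" for j
  proof -
    have "\<tau> (pos j) \<in> {1..2 * (n + 1)}"
      using pos_in(1)[OF j] permutes_in_image[OF \<tau>] by blast
    moreover have "\<tau> (pos j) \<noteq> \<tau> 2" "\<tau> (pos j) \<noteq> \<tau> (2 * n + 1)"
      unfolding inj_eq[OF permutes_inj[OF \<tau>]] by (fact pos_in(2,3)[OF j])+
    ultimately show ?thesis unfolding forced atLeastAtMost_iff by presburger
  qed
  have "shrink_derangement n \<tau> permutes {1..2 * n}"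
  proof (rule permutes_if_inj_on)
    show "inj_on (shrink_derangement n \<tau>) {1..2 * n}"
    proof (rule inj_onI)
      fix i j assume ij: "i \<in> {1..2 * n}" "j \<in> {1..2 * n}"
        "shrink_derangement n \<tau> i = shrink_derangement n \<tau> j"
      then have "\<tau> (pos i) - 1 = \<tau> (pos j) - 1"
        by (simp only: shrink_derangement_def if_True pos_def)
      then have "\<tau> (pos i) = \<tau> (pos j)"
        using range[OF ij(1)] range[OF ij(2)] by linarith
      then have "pos i = pos j"
        by (rule injD[OF permutes_inj[OF \<tau>]])
      then show "i = j" by (auto simp: pos_def split: if_splits)
    qed
    show "shrink_derangement n \<tau> j \<in> {1..2 * n}" if "j \<in> {1..2 * n}" for j
      using range[OF that] that unfolding shrink_derangement_def pos_def by auto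
  qed (auto simp: shrink_derangement_def)
  moreover have "(odd i \<longrightarrow> i \<le> shrink_derangement n \<tau> i) \<and>
      (even i \<longrightarrow> i \<ge> shrink_derangement n \<tau> i)" if "i \<in> {1..2 * n}" for i
    using that step[OF pos_in(1)[OF that]] by (auto simp: shrink_derangement_def pos_def)
  ultimately show ?thesis by (simp add: D_permutation_def)
qed

lemma Dumont_derangement_expand_permutation:
  assumes "D_permutation n \<sigma>"
  shows "Dumont_derangement (n + 1) (expand_permutation n \<sigma>)"
proof -
  define pos where "pos i = (if even i then i - 2 else i)" for i :: nat
  let ?I = "{1..2 * (n + 1)} - {2, 2 * n + 1}"
  let ?\<tau> = "expand_permutation n \<sigma>"
  have \<sigma>: "\<sigma> permutes {1..2 * n}" and
    step: "\<And>i. i \<in> {1..2 * n} \<Longrightarrow> (odd i \<longrightarrow> i \<le> \<sigma> i) \<and> (even i \<longrightarrow> \<sigma> i \<le> i)"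
    using assms unfolding D_permutation_def by blast+
  have pos_in: "pos i \<in> {1..2 * n}" if "i \<in> ?I" for i
    using that unfolding pos_def by auto presburger+
  have inside: "?\<tau> i = \<sigma> (pos i) + 1" if "i \<in> ?I" for i
    using that by (auto simp: expand_permutation_def pos_def)
  have at_2: "?\<tau> 2 = 1" and at_top: "?\<tau> (2 * n + 1) = 2 * (n + 1)"
    by (auto simp: expand_permutation_def)
  have range: "2 \<le> ?\<tau> i \<and> ?\<tau> i \<le> 2 * n + 1" if "i \<in> ?I" for i
    using permutes_in_image[OF \<sigma>, of "pos i"] pos_in[OF that] inside[OF that] by auto
  have split: "{1..2 * (n + 1)} = {2, 2 * n + 1} \<union> ?I"
    by auto
  have "?\<tau> permutes {1..2 * (n + 1)}"
  proof (rule permutes_if_inj_on)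
    have "inj_on ?\<tau> ?I"
    proof (rule inj_onI)
      fix i j assume ij: "i \<in> ?I" "j \<in> ?I" "?\<tau> i = ?\<tau> j"
      then have "\<sigma> (pos i) = \<sigma> (pos j)"
        by (simp only: inside add_right_cancel)
      then have "pos i = pos j"
        by (rule injD[OF permutes_inj[OF \<sigma>]])
      then show "i = j"
        using ij by (auto simp: pos_def split: if_splits)
    qed
    \<comment> \<open>The two special positions and all others have disjoint images, so injectivity
      can be glued from the two pieces.\<close>
    moreover have "?\<tau> ` {2, 2 * n + 1} = {1, 2 * (n + 1)}" "?\<tau> ` ?I \<subseteq> {2..2 * n + 1}"
      using at_2 at_top range unfolding image_subset_iff atLeastAtMost_iff by (simp, blast)
    moreover have "{1, 2 * (n + 1)} \<inter> {2..2 * n + 1} = {}" by auto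
    moreover have "inj_on ?\<tau> {2, 2 * n + 1}" using at_2 at_top by simp
    ultimately have "inj_on ?\<tau> ({2, 2 * n + 1} \<union> ?I)"
      unfolding inj_on_Un by blast
    then show "inj_on ?\<tau> {1..2 * (n + 1)}"
      by (simp only: split[symmetric])
    show "?\<tau> i \<in> {1..2 * (n + 1)}" if "i \<in> {1..2 * (n + 1)}" for i
    proof (cases "i \<in> ?I")
      case True
      then show ?thesis using range[OF True] by auto
    next
      case False
      then have "i = 2 \<or> i = 2 * n + 1" using that by blast
      then show ?thesis using at_2 at_top by auto
    qed
  qed (auto simp: expand_permutation_def)
  moreover have "(odd i \<longrightarrow> i < ?\<tau> i) \<and> (even i \<longrightarrow> ?\<tau> i < i)" if "i \<in> {1..2 * (n + 1)}" for i
  proof (cases "i \<in> ?I")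
    case True
    \<comment> \<open>This makes the truncated \<open>i - 2\<close> exact, so that a value of at
      most \<open>i - 2\<close>, raised by one, is below \<open>i\<close>.\<close>
    have "i \<ge> 2" if "even i" using True that by (cases "i = 1") auto
    then show ?thesis using step[OF pos_in[OF True]] inside[OF True] True by (auto simp: pos_def split: if_splits)
  next
    case False
    then have "i = 2 \<or> i = 2 * n + 1" using that by blast
    then show ?thesis using at_2 at_top by auto
  qed
  ultimately show ?thesis by (simp add: Dumont_derangement_iff)
qed

lemma shrink_expand:
  assumes "D_permutation n \<sigma>"
  shows "shrink_derangement n (expand_permutation n \<sigma>) = \<sigma>"
proof
  fix j
  show "shrink_derangement n (expand_permutation n \<sigma>) j = \<sigma> j"
  proof (cases "j \<in> {1..2 * n}")
    case True
    moreover from this have "odd j \<Longrightarrow> j \<noteq> 2 * n + 1" "even j \<Longrightarrow> j + 2 \<noteq> 2 * n + 1"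
      by (auto, presburger)
    ultimately show ?thesis
      by (auto simp: shrink_derangement_def expand_permutation_def)
  next
    case False
    then show ?thesis
      using assms permutes_not_in[of \<sigma> "{1..2 * n}" j]
      by (auto simp: D_permutation_def shrink_derangement_def)
  qed
qed

lemma expand_shrink:
  assumes "Dumont_derangement (n + 1) \<tau>"
  shows "expand_permutation n (shrink_derangement n \<tau>) = \<tau>"
proof
  fix i
  have \<tau>: "\<tau> permutes {1..2 * (n + 1)}"
    using assms unfolding Dumont_derangement_iff by blast+
  note forced = Dumont_derangement_forced[OF assms]
  consider "i \<notin> {1..2 * (n + 1)}" | "i = 2" | "i = 2 * n + 1"
    | "i \<in> {1..2 * (n + 1)}" "i \<noteq> 2" "i \<noteq> 2 * n + 1" by blast
  then show "expand_permutation n (shrink_derangement n \<tau>) i = \<tau> i"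
  proof cases
    case 1
    then show ?thesis using permutes_not_in[OF \<tau> 1] unfolding expand_permutation_def by simp
  next
    case 2
    then show ?thesis using forced by (simp add: expand_permutation_def)
  next
    case 3
    moreover from this have "i \<noteq> 2" by presburger
    ultimately show ?thesis using forced by (simp add: expand_permutation_def)
  next
    case 4
    define j where "j = (if even i then i - 2 else i)"
    have "j \<in> {1..2 * n}" "(if even j then j + 2 else j) = i"
      using 4 unfolding j_def by (auto, presburger+)
    then have "shrink_derangement n \<tau> j = \<tau> i - 1"
      by (simp only: shrink_derangement_def if_True)
    \<comment> \<open>Positivity is what lets lowering and raising the value by one cancel.\<close>
    moreover have "1 \<le> \<tau> i"
      using 4 permutes_in_image[OF \<tau>, of i] by auto
    ultimately show ?thesis
      using 4 by (simp add: expand_permutation_def j_def)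
  qed
qed

lemma card_D_permutations:
  "card {\<sigma>. D_permutation n \<sigma>} = median_genocchi n"
proof -
  have "bij_betw (expand_permutation n) {\<sigma>. D_permutation n \<sigma>} {\<tau>. Dumont_derangement (n + 1) \<tau>}"
    by (rule bij_betw_byWitness[where f' = "shrink_derangement n"])
      (use shrink_expand expand_shrink D_permutation_shrink_derangement
        Dumont_derangement_expand_permutation in auto)
  then show ?thesis
    unfolding median_genocchi_def by (rule bij_betw_same_card)
qed

theorem theorem4p2:
  fixes n :: nat
  assumes "n \<ge> 1"
  shows "card {\<sigma>. D_permutation n \<sigma> \<and> cyclic_on \<sigma> {1..2 * n}} = genocchi n \<and>
         card {\<sigma>. D_permutation n \<sigma>} = median_genocchi n"
  using card_D_cycles[OF assms] card_D_permutations by blast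

end
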